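(* 1. Let $(G,\cdot)$ be a group and let $\psi:G\to G$ be an idempotent abelian map (so $\psi\circ\psi=\psi$ as maps), and put $\phi(g)=g\psi(g^{-1})$ for $g\in G$. Then $$R(x,y)=\left(\psi(x)\phi(y)\psi(x^{-1}),\ \psi(x)\phi(y)^{-1}\psi(x^{-1})xy\right),\qquad x,y\in G,$$ is a right non-degenerate solution to the Yang-Baxter equation on the set $G$. 2. Let $G_1,G_2$ be groups, $G=G_1\times G_2$, and let $\alpha:G_1\to G_2$ and $\beta:G_2\to G_1$ be abelian maps. Then $$R((x_1,x_2),(y_1,y_2))=\left(\lambda_{(x_1,x_2)}(y_1,y_2),\ \rho_{(y_1,y_2)}(x_1,x_2)\right)$$ is a right non-degenerate solution to the Yang-Baxter equation on the set $G$, where $$\lambda_{(x_1,x_2)}(y_1,y_2)=\left(e,\ \alpha(x_1^{-1})y_2\alpha(x_1)\right),$$ $$\rho_{(y_1,y_2)}(x_1,x_2)=\left(\beta(y_2)x_1\beta(x_2^{-1})y_1\beta(x_2y_2^{-1}),\ \alpha(x_1)^{-1}y_2^{-1}\alpha(x_1)x_2\alpha(x_1)^{-1}y_2\alpha(x_1)\right).$$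
   Context: For groups $G,G'$, an abelian map $G\to G'$ is a group homomorphism whose image is an abelian subgroup of $G'$. An abelian map on $G$ is an abelian map $G\to G$. The identity element of a group is denoted $e$. A (set-theoretic) solution to the Yang-Baxter equation on a set $B$ is a map $R:B\times B\to B\times B$ with $(R\times\mathrm{id})(\mathrm{id}\times R)(R\times\mathrm{id})=(\mathrm{id}\times R)(R\times\mathrm{id})(\mathrm{id}\times R)$ as maps $B^3\to B^3$. Writing $R(x,y)=(\lambda_x(y),\rho_y(x))$, the solution $R$ is right non-degenerate if for each $y\in B$ the map $\rho_y:B\to B$ is a bijection. *)

theory Defs
  imports "HOL-Algebra.Group"
begin

definition abelian_map ::
  "('a, 'm) monoid_scheme \<Rightarrow> ('b, 'n) monoid_scheme \<Rightarrow> ('a \<Rightarrow> 'b) \<Rightarrow> bool" where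
  "abelian_map G H f \<longleftrightarrow>
     f \<in> hom G H \<and> subgroup (f ` carrier G) H \<and>
     comm_group (H\<lparr>carrier := f ` carrier G\<rparr>)"

definition map12 :: "('b \<times> 'b \<Rightarrow> 'b \<times> 'b) \<Rightarrow> 'b \<times> 'b \<times> 'b \<Rightarrow> 'b \<times> 'b \<times> 'b" where
  "map12 R = (\<lambda>(x, y, z). case R (x, y) of (x', y') \<Rightarrow> (x', y', z))"

definition map23 :: "('b \<times> 'b \<Rightarrow> 'b \<times> 'b) \<Rightarrow> 'b \<times> 'b \<times> 'b \<Rightarrow> 'b \<times> 'b \<times> 'b" where
  "map23 R = (\<lambda>(x, y, z). (x, R (y, z)))"

(* Maps on a set B are represented by total HOL functions; their values outside B are irrelevant. *)

definition ybe_solution :: "'b set \<Rightarrow> ('b \<times> 'b \<Rightarrow> 'b \<times> 'b) \<Rightarrow> bool" where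
  "ybe_solution B R \<longleftrightarrow>
     R \<in> B \<times> B \<rightarrow> B \<times> B \<and>
     (\<forall>t \<in> B \<times> B \<times> B.
        (map12 R \<circ> map23 R \<circ> map12 R) t = (map23 R \<circ> map12 R \<circ> map23 R) t)"

definition right_nondegenerate :: "'b set \<Rightarrow> ('b \<times> 'b \<Rightarrow> 'b \<times> 'b) \<Rightarrow> bool" where
  "right_nondegenerate B R \<longleftrightarrow> (\<forall>y \<in> B. bij_betw (\<lambda>x. snd (R (x, y))) B B)"

definition phi_map :: "('a, 'm) monoid_scheme \<Rightarrow> ('a \<Rightarrow> 'a) \<Rightarrow> 'a \<Rightarrow> 'a" where
  "phi_map G \<psi> g = g \<otimes>\<^bsub>G\<^esub> \<psi> (inv\<^bsub>G\<^esub> g)"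

definition idem_R :: "('a, 'm) monoid_scheme \<Rightarrow> ('a \<Rightarrow> 'a) \<Rightarrow> 'a \<times> 'a \<Rightarrow> 'a \<times> 'a" where
  "idem_R G \<psi> = (\<lambda>(x, y).
     (\<psi> x \<otimes>\<^bsub>G\<^esub> phi_map G \<psi> y \<otimes>\<^bsub>G\<^esub> \<psi> (inv\<^bsub>G\<^esub> x),
      \<psi> x \<otimes>\<^bsub>G\<^esub> inv\<^bsub>G\<^esub> (phi_map G \<psi> y) \<otimes>\<^bsub>G\<^esub> \<psi> (inv\<^bsub>G\<^esub> x) \<otimes>\<^bsub>G\<^esub> x \<otimes>\<^bsub>G\<^esub> y))"

definition prod_lambda ::
  "('a, 'm) monoid_scheme \<Rightarrow> ('b, 'n) monoid_scheme \<Rightarrow> ('a \<Rightarrow> 'b) \<Rightarrow>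
   'a \<times> 'b \<Rightarrow> 'a \<times> 'b \<Rightarrow> 'a \<times> 'b" where
  "prod_lambda G\<^sub>1 G\<^sub>2 \<alpha> = (\<lambda>(x\<^sub>1, x\<^sub>2) (y\<^sub>1, y\<^sub>2).
     (\<one>\<^bsub>G\<^sub>1\<^esub>, \<alpha> (inv\<^bsub>G\<^sub>1\<^esub> x\<^sub>1) \<otimes>\<^bsub>G\<^sub>2\<^esub> y\<^sub>2 \<otimes>\<^bsub>G\<^sub>2\<^esub> \<alpha> x\<^sub>1))"

definition prod_rho ::
  "('a, 'm) monoid_scheme \<Rightarrow> ('b, 'n) monoid_scheme \<Rightarrow> ('a \<Rightarrow> 'b) \<Rightarrow> ('b \<Rightarrow> 'a) \<Rightarrow>
   'a \<times> 'b \<Rightarrow> 'a \<times> 'b \<Rightarrow> 'a \<times> 'b" where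
  "prod_rho G\<^sub>1 G\<^sub>2 \<alpha> \<beta> = (\<lambda>(y\<^sub>1, y\<^sub>2) (x\<^sub>1, x\<^sub>2).
     (\<beta> y\<^sub>2 \<otimes>\<^bsub>G\<^sub>1\<^esub> x\<^sub>1 \<otimes>\<^bsub>G\<^sub>1\<^esub> \<beta> (inv\<^bsub>G\<^sub>2\<^esub> x\<^sub>2) \<otimes>\<^bsub>G\<^sub>1\<^esub> y\<^sub>1 \<otimes>\<^bsub>G\<^sub>1\<^esub> \<beta> (x\<^sub>2 \<otimes>\<^bsub>G\<^sub>2\<^esub> inv\<^bsub>G\<^sub>2\<^esub> y\<^sub>2),
      inv\<^bsub>G\<^sub>2\<^esub> (\<alpha> x\<^sub>1) \<otimes>\<^bsub>G\<^sub>2\<^esub> inv\<^bsub>G\<^sub>2\<^esub> y\<^sub>2 \<otimes>\<^bsub>G\<^sub>2\<^esub> \<alpha> x\<^sub>1 \<otimes>\<^bsub>G\<^sub>2\<^esub> x\<^sub>2 \<otimes>\<^bsub>G\<^sub>2\<^esub> inv\<^bsub>G\<^sub>2\<^esub> (\<alpha> x\<^sub>1)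
        \<otimes>\<^bsub>G\<^sub>2\<^esub> y\<^sub>2 \<otimes>\<^bsub>G\<^sub>2\<^esub> \<alpha> x\<^sub>1))"

definition prod_R ::
  "('a, 'm) monoid_scheme \<Rightarrow> ('b, 'n) monoid_scheme \<Rightarrow> ('a \<Rightarrow> 'b) \<Rightarrow> ('b \<Rightarrow> 'a) \<Rightarrow>
   ('a \<times> 'b) \<times> ('a \<times> 'b) \<Rightarrow> ('a \<times> 'b) \<times> ('a \<times> 'b)" where
  "prod_R G\<^sub>1 G\<^sub>2 \<alpha> \<beta> = (\<lambda>(x, y). (prod_lambda G\<^sub>1 G\<^sub>2 \<alpha> x y, prod_rho G\<^sub>1 G\<^sub>2 \<alpha> \<beta> y x))"

end

theory Submission
  imports Defs
begin

text \<open>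
  Both maps have the shape \<open>R(x, y) = (\<lambda> x y, \<rho> y x)\<close>, and everything rests on how \<open>\<psi>\<close> (respectively
  \<open>\<alpha>, \<beta>\<close>), which is invariant under conjugation, acts on \<open>\<lambda> x y\<close> and \<open>\<rho> y x\<close>.
  In the first part \<open>\<psi> (\<lambda> x y) = \<one>\<close> and \<open>\<psi> (\<rho> y x) = \<psi> x \<psi> y\<close>. The product of the two components of
  \<open>R(x, y)\<close> is \<open>x y\<close>, so the third component of the braid equation follows from the other two by
  cancellation. Nondegeneracy holds since \<open>w = \<rho> y x\<close> determines \<open>\<psi> x = \<psi> (w y\<^sup>-\<^sup>1)\<close> and then \<open>x\<close>.
  In the second part \<open>\<alpha>\<close> of the first component of \<open>\<rho> y x\<close> is \<open>\<alpha> (x\<^sub>1 y\<^sub>1)\<close> and \<open>\<beta>\<close> of its second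
  component is \<open>\<beta> x\<^sub>2\<close>; hence \<open>\<rho> y x\<close> again determines \<open>\<alpha> x\<^sub>1\<close>, \<open>\<beta> x\<^sub>2\<close> and then \<open>x\<close>, and the braid
  equation reduces to word identities in which the values of \<open>\<beta>\<close> commute.
\<close>

section \<open>Componentwise criteria for the Yang-Baxter equation\<close>

lemma ybe_solutionI:
  assumes R: "\<And>x y. \<lbrakk>x \<in> B; y \<in> B\<rbrakk> \<Longrightarrow> R (x, y) = (l x y, r y x)"
    and l: "\<And>x y. \<lbrakk>x \<in> B; y \<in> B\<rbrakk> \<Longrightarrow> l x y \<in> B"
    and r: "\<And>x y. \<lbrakk>x \<in> B; y \<in> B\<rbrakk> \<Longrightarrow> r y x \<in> B"
    and first: "\<And>x y z. \<lbrakk>x \<in> B; y \<in> B; z \<in> B\<rbrakk> \<Longrightarrow> l (l x y) (l (r y x) z) = l x (l y z)"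
    and second: "\<And>x y z. \<lbrakk>x \<in> B; y \<in> B; z \<in> B\<rbrakk> \<Longrightarrow>
      r (l (r y x) z) (l x y) = l (r (l y z) x) (r z y)"
    and third: "\<And>x y z. \<lbrakk>x \<in> B; y \<in> B; z \<in> B\<rbrakk> \<Longrightarrow> r z (r y x) = r (r z y) (r (l y z) x)"
  shows "ybe_solution B R"
  unfolding ybe_solution_def
proof (intro conjI ballI)
  show "R \<in> B \<times> B \<rightarrow> B \<times> B"
    using R l r by auto
  fix t assume "t \<in> B \<times> B \<times> B"
  then obtain x y z where t: "t = (x, y, z)" and xyz: "x \<in> B" "y \<in> B" "z \<in> B"
    by auto
  show "(map12 R \<circ> map23 R \<circ> map12 R) t = (map23 R \<circ> map12 R \<circ> map23 R) t"
    unfolding t map12_def map23_def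
    by (simp add: R l r xyz first[OF xyz] second[OF xyz] third[OF xyz])
qed

context group
begin

text \<open>In a right-nested word a letter and its neighbouring inverse are no longer the two
  factors of one product. These rules cancel them there, so that together with
  \<open>word_simps\<close> group words are freely reduced.\<close>

lemma inv_mult_cancel [simp]:
  assumes "x \<in> carrier G" "y \<in> carrier G"
  shows "inv x \<otimes> (x \<otimes> y) = y" "x \<otimes> (inv x \<otimes> y) = y"
  using assms by (simp_all flip: m_assoc)

lemmas word_simps = m_assoc inv_mult_group

text \<open>Applying \<open>R\<close> to adjacent entries of a triple keeps the product of the
  triple. Both sides of the braid relation thus have product x y z, and agreement in the first two
  entries forces agreement in the third.\<close>

lemma ybe_solution_product_preserving:
  assumes R: "\<And>x y. \<lbrakk>x \<in> carrier G; y \<in> carrier G\<rbrakk> \<Longrightarrow> R (x, y) = (l x y, r y x)"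
    and l: "\<And>x y. \<lbrakk>x \<in> carrier G; y \<in> carrier G\<rbrakk> \<Longrightarrow> l x y \<in> carrier G"
    and r: "\<And>x y. \<lbrakk>x \<in> carrier G; y \<in> carrier G\<rbrakk> \<Longrightarrow> r y x \<in> carrier G"
    and prod: "\<And>x y. \<lbrakk>x \<in> carrier G; y \<in> carrier G\<rbrakk> \<Longrightarrow> l x y \<otimes> r y x = x \<otimes> y"
    and first: "\<And>x y z. \<lbrakk>x \<in> carrier G; y \<in> carrier G; z \<in> carrier G\<rbrakk> \<Longrightarrow>
      l (l x y) (l (r y x) z) = l x (l y z)"
    and second: "\<And>x y z. \<lbrakk>x \<in> carrier G; y \<in> carrier G; z \<in> carrier G\<rbrakk> \<Longrightarrow>
      r (l (r y x) z) (l x y) = l (r (l y z) x) (r z y)"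
  shows "ybe_solution (carrier G) R"
proof (rule ybe_solutionI[where l = l and r = r])
  fix x y z assume x: "x \<in> carrier G" and y: "y \<in> carrier G" and z: "z \<in> carrier G"
  \<comment> \<open>\<open>a\<close> and \<open>b\<close> are the first two entries of the side that
    starts with \<open>map23\<close>. By \<open>first\<close> and \<open>second\<close> they are
    also those of the other side.\<close>
  define a where "a = l x (l y z)"
  define b where "b = l (r (l y z) x) (r z y)"
  have a: "a \<in> carrier G" and b: "b \<in> carrier G"
    using x y z l r by (simp_all add: a_def b_def)
  have "a \<otimes> (b \<otimes> r z (r y x)) = (a \<otimes> b) \<otimes> r z (r y x)"
    using a b x y z r by (simp add: m_assoc)
  also have "a \<otimes> b = l x y \<otimes> l (r y x) z"
    using prod[of "l x y" "l (r y x) z"] first[of x y z] second[of x y z] x y z l r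
    by (simp add: a_def b_def)
  also have "\<dots> \<otimes> r z (r y x) = l x y \<otimes> (l (r y x) z \<otimes> r z (r y x))"
    using x y z l r by (simp add: m_assoc)
  also have "\<dots> = l x y \<otimes> r y x \<otimes> z"
    using x y z l r prod[of "r y x" z] by (simp add: m_assoc)
  also have "\<dots> = x \<otimes> (y \<otimes> z)"
    using x y z prod[of x y] by (simp add: m_assoc)
  also have "\<dots> = x \<otimes> l y z \<otimes> r z y"
    using x y z l r prod[of y z] by (simp add: m_assoc)
  also have "\<dots> = a \<otimes> r (l y z) x \<otimes> r z y"
    using x y z l r prod[of x "l y z"] by (simp add: a_def)
  also have "\<dots> = a \<otimes> (b \<otimes> r (r z y) (r (l y z) x))"
    using x y z l r a prod[of "r (l y z) x" "r z y"] by (simp add: b_def m_assoc)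
  finally show "r z (r y x) = r (r z y) (r (l y z) x)"
    using a b x y z l r by simp
qed (simp_all only: R l r first second)

end

section \<open>Homomorphisms with commuting values\<close>

locale abelian_image_hom = group_hom +
  assumes image_comm: "\<lbrakk>x \<in> carrier G; y \<in> carrier G\<rbrakk> \<Longrightarrow> h x \<otimes>\<^bsub>H\<^esub> h y = h y \<otimes>\<^bsub>H\<^esub> h x"
begin

lemma image_conj:
  assumes "x \<in> carrier G" "y \<in> carrier G"
  shows "h x \<otimes>\<^bsub>H\<^esub> h y \<otimes>\<^bsub>H\<^esub> inv\<^bsub>H\<^esub> h x = h y" "inv\<^bsub>H\<^esub> h x \<otimes>\<^bsub>H\<^esub> h y \<otimes>\<^bsub>H\<^esub> h x = h y"
  using assms by (simp_all add: image_comm[of x y] H.m_assoc) (simp add: image_comm[of y x])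

text \<open>The image of a conjugate is a conjugate by a value of \<open>h\<close>, which commutes
  with all values of \<open>h\<close>.\<close>

lemma hom_conj:
  assumes "x \<in> carrier G" "y \<in> carrier G"
  shows "h (x \<otimes> y \<otimes> inv x) = h y" "h (inv x \<otimes> y \<otimes> x) = h y"
  using assms image_conj by simp_all

end

lemma abelian_image_homI:
  assumes "group G" "group H" "abelian_map G H f"
  shows "abelian_image_hom G H f"
proof -
  have hom: "f \<in> hom G H" and comm: "comm_group (H\<lparr>carrier := f ` carrier G\<rparr>)"
    using assms(3) by (auto simp: abelian_map_def)
  interpret group_hom G H f
    using assms(1,2) hom by (simp add: group_hom_def group_hom_axioms_def)
  show ?thesis
  proof unfold_locales
    fix x y assume "x \<in> carrier G" "y \<in> carrier G"
    then show "f x \<otimes>\<^bsub>H\<^esub> f y = f y \<otimes>\<^bsub>H\<^esub> f x"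
      using comm_monoid.m_comm[OF comm_group.axioms(1)[OF comm], of "f x" "f y"] by simp
  qed
qed

section \<open>Idempotent abelian maps on one group\<close>

locale idempotent_abelian_map = abelian_image_hom G G \<psi> for G (structure) and \<psi> +
  assumes idem [simp]: "x \<in> carrier G \<Longrightarrow> \<psi> (\<psi> x) = \<psi> x"
begin

definition lam where "lam x y = \<psi> x \<otimes> (y \<otimes> inv (\<psi> y)) \<otimes> inv (\<psi> x)"
text \<open>The factor \<psi>(x) \<phi>(y)^-1 \<psi>(x^-1) of the second component is the inverse of
  the first component. In this form preservation of the product is immediate.\<close>

definition rho where "rho y x = inv (lam x y) \<otimes> x \<otimes> y"

lemma lam_closed [simp]: "\<lbrakk>x \<in> carrier G; y \<in> carrier G\<rbrakk> \<Longrightarrow> lam x y \<in> carrier G"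
  by (simp add: lam_def)

lemma rho_closed [simp]: "\<lbrakk>x \<in> carrier G; y \<in> carrier G\<rbrakk> \<Longrightarrow> rho y x \<in> carrier G"
  by (simp add: rho_def)

lemma idem_R_eq:
  assumes "x \<in> carrier G" "y \<in> carrier G"
  shows "idem_R G \<psi> (x, y) = (lam x y, rho y x)"
  using assms by (simp add: idem_R_def phi_map_def lam_def rho_def G.word_simps)

text \<open>Idempotence puts y \<psi>(y)^-1 into the kernel of \<psi>, and the kernel is closed
  under conjugation.\<close>

lemma psi_lam [simp]:
  assumes "x \<in> carrier G" "y \<in> carrier G"
  shows "\<psi> (lam x y) = \<one>"
  using assms by (simp add: lam_def)

lemma psi_rho [simp]:
  assumes "x \<in> carrier G" "y \<in> carrier G"
  shows "\<psi> (rho y x) = \<psi> x \<otimes> \<psi> y"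
  using assms by (simp add: rho_def)

lemma lam_trivial:
  assumes "a \<in> carrier G" "y \<in> carrier G" "\<psi> a = \<one>"
  shows "lam a y = y \<otimes> inv (\<psi> y)"
  using assms by (simp add: lam_def)

lemma lam_lam:
  assumes "x \<in> carrier G" "y \<in> carrier G" "z \<in> carrier G"
  shows "lam x (lam y z) = \<psi> x \<otimes> lam y z \<otimes> inv (\<psi> x)"
  using assms by (simp add: lam_def[of x "lam y z"])

lemma ybe_solution: "ybe_solution (carrier G) (idem_R G \<psi>)"
proof (rule G.ybe_solution_product_preserving[where l = lam and r = rho])
  fix x y assume xy: "x \<in> carrier G" "y \<in> carrier G"
  then show "lam x y \<otimes> rho y x = x \<otimes> y"
    by (simp add: rho_def G.m_assoc)
  fix z assume z: "z \<in> carrier G"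
  show "lam (lam x y) (lam (rho y x) z) = lam x (lam y z)"
    using xy z by (simp add: lam_lam) (simp add: lam_def G.word_simps)
  \<comment> \<open>Put A = \<open>lam x y\<close> and C = \<open>lam (rho y x) z\<close>. Since
    \<psi> is trivial on A and C, the left side is C^-1 A C. On the right the outer conjugation is
    by \<psi> x, because \<psi> kills \<open>lam y z\<close>; expanding \<open>lam\<close> gives the
    same reduced word.\<close>
  show "rho (lam (rho y x) z) (lam x y) = lam (rho (lam y z) x) (rho z y)"
    using xy z
    by (simp add: rho_def[of "lam (rho y x) z"] lam_trivial)
      (simp add: lam_def[of "rho (lam y z) x"],
        simp add: rho_def[of z y],
        simp add: lam_def G.word_simps)
qed (simp_all add: idem_R_eq)

lemma right_nondegenerate: "right_nondegenerate (carrier G) (idem_R G \<psi>)"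
  unfolding right_nondegenerate_def
proof
  fix y assume y: "y \<in> carrier G"
  show "bij_betw (\<lambda>x. snd (idem_R G \<psi> (x, y))) (carrier G) (carrier G)"
  \<comment> \<open>Solving w = \<open>rho y x\<close> for x gives x = \<open>lam x y\<close> w
    y^-1. Here \<open>lam x y\<close> depends on x only through \<psi> x, which equals \<psi>(w
    y^-1).\<close>
  proof (rule bij_betwI[where g = "\<lambda>w. lam (w \<otimes> inv y) y \<otimes> w \<otimes> inv y"])
    fix x assume x: "x \<in> carrier G"
    have "lam (rho y x \<otimes> inv y) y = lam x y"
      using x y by (simp add: lam_def[of _ y] G.word_simps)
    then show "lam (snd (idem_R G \<psi> (x, y)) \<otimes> inv y) y \<otimes> snd (idem_R G \<psi> (x, y)) \<otimes> inv y = x"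
      using x y by (simp add: idem_R_eq) (simp add: rho_def G.m_assoc)
  next
    fix w assume w: "w \<in> carrier G"
    define x where "x = lam (w \<otimes> inv y) y \<otimes> w \<otimes> inv y"
    have x: "x \<in> carrier G" using w y by (simp add: x_def)
    \<comment> \<open>\<psi> kills the leading factor of x, which leaves \<psi> x = \<psi>(w
      y^-1).\<close>
    have "lam x y = lam (w \<otimes> inv y) y"
      using w y x by (simp add: lam_def[of _ y]) (simp add: x_def)
    then have "rho y x = w"
      using w y x by (simp add: rho_def) (simp add: x_def G.m_assoc)
    then show "snd (idem_R G \<psi> (lam (w \<otimes> inv y) y \<otimes> w \<otimes> inv y, y)) = w"
      using x y by (simp add: idem_R_eq flip: x_def)
  qed (use y in \<open>auto simp: idem_R_eq\<close>)
qed

end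

section \<open>Pairs of abelian maps between two groups\<close>

locale abelian_map_pair =
  \<alpha>: abelian_image_hom G\<^sub>1 G\<^sub>2 \<alpha> + \<beta>: abelian_image_hom G\<^sub>2 G\<^sub>1 \<beta>
  for G\<^sub>1 (structure) and G\<^sub>2 (structure) and \<alpha> \<beta>
begin

definition lam where "lam x\<^sub>1 y\<^sub>2 = inv\<^bsub>G\<^sub>2\<^esub> (\<alpha> x\<^sub>1) \<otimes>\<^bsub>G\<^sub>2\<^esub> y\<^sub>2 \<otimes>\<^bsub>G\<^sub>2\<^esub> \<alpha> x\<^sub>1"

text \<open>Splitting \<beta> of x2 y2^-1 exposes an inner conjugation of y1 and an outer
  conjugation of the whole product, both of which disappear under \<alpha>.\<close>

definition rho\<^sub>1 where
  "rho\<^sub>1 y\<^sub>1 y\<^sub>2 x\<^sub>1 x\<^sub>2 = \<beta> y\<^sub>2 \<otimes>\<^bsub>G\<^sub>1\<^esub> (x\<^sub>1 \<otimes>\<^bsub>G\<^sub>1\<^esub> (inv\<^bsub>G\<^sub>1\<^esub> \<beta> x\<^sub>2 \<otimes>\<^bsub>G\<^sub>1\<^esub> y\<^sub>1 \<otimes>\<^bsub>G\<^sub>1\<^esub> \<beta> x\<^sub>2)) \<otimes>\<^bsub>G\<^sub>1\<^esub> inv\<^bsub>G\<^sub>1\<^esub> \<beta> y\<^sub>2"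

definition rho\<^sub>2 where
  "rho\<^sub>2 y\<^sub>2 x\<^sub>1 x\<^sub>2 = inv\<^bsub>G\<^sub>2\<^esub> (lam x\<^sub>1 y\<^sub>2) \<otimes>\<^bsub>G\<^sub>2\<^esub> x\<^sub>2 \<otimes>\<^bsub>G\<^sub>2\<^esub> lam x\<^sub>1 y\<^sub>2"

lemma closed [simp]:
  assumes "x\<^sub>1 \<in> carrier G\<^sub>1" "x\<^sub>2 \<in> carrier G\<^sub>2" "y\<^sub>1 \<in> carrier G\<^sub>1" "y\<^sub>2 \<in> carrier G\<^sub>2"
  shows "lam x\<^sub>1 y\<^sub>2 \<in> carrier G\<^sub>2" "rho\<^sub>1 y\<^sub>1 y\<^sub>2 x\<^sub>1 x\<^sub>2 \<in> carrier G\<^sub>1" "rho\<^sub>2 y\<^sub>2 x\<^sub>1 x\<^sub>2 \<in> carrier G\<^sub>2"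
  using assms by (simp_all add: lam_def rho\<^sub>1_def rho\<^sub>2_def)

lemma prod_R_eq:
  assumes "x\<^sub>1 \<in> carrier G\<^sub>1" "x\<^sub>2 \<in> carrier G\<^sub>2" "y\<^sub>1 \<in> carrier G\<^sub>1" "y\<^sub>2 \<in> carrier G\<^sub>2"
  shows "prod_R G\<^sub>1 G\<^sub>2 \<alpha> \<beta> ((x\<^sub>1, x\<^sub>2), (y\<^sub>1, y\<^sub>2)) =
    ((\<one>\<^bsub>G\<^sub>1\<^esub>, lam x\<^sub>1 y\<^sub>2), (rho\<^sub>1 y\<^sub>1 y\<^sub>2 x\<^sub>1 x\<^sub>2, rho\<^sub>2 y\<^sub>2 x\<^sub>1 x\<^sub>2))"
  using assms
  by (simp add: prod_R_def prod_lambda_def prod_rho_def lam_def rho\<^sub>1_def rho\<^sub>2_def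
      \<alpha>.G.word_simps \<alpha>.H.word_simps)

lemma beta_lam [simp]:
  assumes "x\<^sub>1 \<in> carrier G\<^sub>1" "y\<^sub>2 \<in> carrier G\<^sub>2"
  shows "\<beta> (lam x\<^sub>1 y\<^sub>2) = \<beta> y\<^sub>2"
  using assms by (simp add: lam_def \<beta>.hom_conj del: \<beta>.hom_mult)

lemma beta_rho\<^sub>2 [simp]:
  assumes "x\<^sub>1 \<in> carrier G\<^sub>1" "x\<^sub>2 \<in> carrier G\<^sub>2" "y\<^sub>2 \<in> carrier G\<^sub>2"
  shows "\<beta> (rho\<^sub>2 y\<^sub>2 x\<^sub>1 x\<^sub>2) = \<beta> x\<^sub>2"
  using assms by (simp add: rho\<^sub>2_def \<beta>.hom_conj del: \<beta>.hom_mult)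

text \<open>The order of the two commuting factors is chosen so that conjugating by this value is,
  as a word, conjugating first by \<alpha> y1 and then by \<alpha> x1, as in
  \<open>lam x\<^sub>1 (lam y\<^sub>1 z\<^sub>2)\<close>.\<close>

lemma alpha_rho\<^sub>1 [simp]:
  assumes "x\<^sub>1 \<in> carrier G\<^sub>1" "x\<^sub>2 \<in> carrier G\<^sub>2" "y\<^sub>1 \<in> carrier G\<^sub>1" "y\<^sub>2 \<in> carrier G\<^sub>2"
  shows "\<alpha> (rho\<^sub>1 y\<^sub>1 y\<^sub>2 x\<^sub>1 x\<^sub>2) = \<alpha> y\<^sub>1 \<otimes>\<^bsub>G\<^sub>2\<^esub> \<alpha> x\<^sub>1"
proof -
  have "\<alpha> (rho\<^sub>1 y\<^sub>1 y\<^sub>2 x\<^sub>1 x\<^sub>2) = \<alpha> (x\<^sub>1 \<otimes>\<^bsub>G\<^sub>1\<^esub> (inv\<^bsub>G\<^sub>1\<^esub> \<beta> x\<^sub>2 \<otimes>\<^bsub>G\<^sub>1\<^esub> y\<^sub>1 \<otimes>\<^bsub>G\<^sub>1\<^esub> \<beta> x\<^sub>2))"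
    unfolding rho\<^sub>1_def using assms by (intro \<alpha>.hom_conj) auto
  also have "\<dots> = \<alpha> x\<^sub>1 \<otimes>\<^bsub>G\<^sub>2\<^esub> \<alpha> (inv\<^bsub>G\<^sub>1\<^esub> \<beta> x\<^sub>2 \<otimes>\<^bsub>G\<^sub>1\<^esub> y\<^sub>1 \<otimes>\<^bsub>G\<^sub>1\<^esub> \<beta> x\<^sub>2)"
    using assms by (intro \<alpha>.hom_mult) auto
  also have "\<alpha> (inv\<^bsub>G\<^sub>1\<^esub> \<beta> x\<^sub>2 \<otimes>\<^bsub>G\<^sub>1\<^esub> y\<^sub>1 \<otimes>\<^bsub>G\<^sub>1\<^esub> \<beta> x\<^sub>2) = \<alpha> y\<^sub>1"
    using assms by (intro \<alpha>.hom_conj) auto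
  also have "\<alpha> x\<^sub>1 \<otimes>\<^bsub>G\<^sub>2\<^esub> \<alpha> y\<^sub>1 = \<alpha> y\<^sub>1 \<otimes>\<^bsub>G\<^sub>2\<^esub> \<alpha> x\<^sub>1"
    using assms by (intro \<alpha>.image_comm) auto
  finally show ?thesis .
qed

lemma rho\<^sub>1_one:
  assumes "x\<^sub>1 \<in> carrier G\<^sub>1" "x\<^sub>2 \<in> carrier G\<^sub>2" "y\<^sub>2 \<in> carrier G\<^sub>2"
  shows "rho\<^sub>1 \<one>\<^bsub>G\<^sub>1\<^esub> y\<^sub>2 x\<^sub>1 x\<^sub>2 = \<beta> y\<^sub>2 \<otimes>\<^bsub>G\<^sub>1\<^esub> x\<^sub>1 \<otimes>\<^bsub>G\<^sub>1\<^esub> inv\<^bsub>G\<^sub>1\<^esub> \<beta> y\<^sub>2"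
  using assms by (simp add: rho\<^sub>1_def)

text \<open>With a, b, c the values of \<beta> at x2, y2, z2, both sides reduce to c b x1 a^-1 y1
  b^-1 z1 a c^-1.\<close>

lemma rho\<^sub>1_braid:
  assumes "x\<^sub>1 \<in> carrier G\<^sub>1" "y\<^sub>1 \<in> carrier G\<^sub>1" "z\<^sub>1 \<in> carrier G\<^sub>1"
    and "x\<^sub>2 \<in> carrier G\<^sub>2" "y\<^sub>2 \<in> carrier G\<^sub>2" "z\<^sub>2 \<in> carrier G\<^sub>2"
  shows "rho\<^sub>1 z\<^sub>1 z\<^sub>2 (rho\<^sub>1 y\<^sub>1 y\<^sub>2 x\<^sub>1 x\<^sub>2) (rho\<^sub>2 y\<^sub>2 x\<^sub>1 x\<^sub>2) =
    rho\<^sub>1 (rho\<^sub>1 z\<^sub>1 z\<^sub>2 y\<^sub>1 y\<^sub>2) (rho\<^sub>2 z\<^sub>2 y\<^sub>1 y\<^sub>2)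
      (rho\<^sub>1 \<one>\<^bsub>G\<^sub>1\<^esub> (lam y\<^sub>1 z\<^sub>2) x\<^sub>1 x\<^sub>2) (rho\<^sub>2 (lam y\<^sub>1 z\<^sub>2) x\<^sub>1 x\<^sub>2)"
proof -
  let ?a = "\<beta> x\<^sub>2" and ?b = "\<beta> y\<^sub>2" and ?c = "\<beta> z\<^sub>2"
  let ?i = "\<lambda>u. inv\<^bsub>G\<^sub>1\<^esub> u"
  \<comment> \<open>Commutation of the values of \<beta>, in the form needed inside a right-nested
    word: u is the rest of the word after the rewritten letters. At the end of the word there is no
    rest, and \<open>tail\<close> applies.\<close>
  have conj: "?a \<otimes>\<^bsub>G\<^sub>1\<^esub> (?i ?b \<otimes>\<^bsub>G\<^sub>1\<^esub> (?i ?a \<otimes>\<^bsub>G\<^sub>1\<^esub> u)) = ?i ?b \<otimes>\<^bsub>G\<^sub>1\<^esub> u"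
    "?i ?c \<otimes>\<^bsub>G\<^sub>1\<^esub> (?i ?a \<otimes>\<^bsub>G\<^sub>1\<^esub> (?c \<otimes>\<^bsub>G\<^sub>1\<^esub> u)) = ?i ?a \<otimes>\<^bsub>G\<^sub>1\<^esub> u"
    "?b \<otimes>\<^bsub>G\<^sub>1\<^esub> (?c \<otimes>\<^bsub>G\<^sub>1\<^esub> u) = ?c \<otimes>\<^bsub>G\<^sub>1\<^esub> (?b \<otimes>\<^bsub>G\<^sub>1\<^esub> u)"
    if "u \<in> carrier G\<^sub>1" for u
    using that assms \<beta>.image_conj(1)[of x\<^sub>2 "inv\<^bsub>G\<^sub>2\<^esub> y\<^sub>2"] \<beta>.image_conj(2)[of z\<^sub>2 "inv\<^bsub>G\<^sub>2\<^esub> x\<^sub>2"]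
      \<beta>.image_comm[of y\<^sub>2 z\<^sub>2]
    by (simp_all flip: \<alpha>.G.m_assoc)
  have tail: "?b \<otimes>\<^bsub>G\<^sub>1\<^esub> (?i ?c \<otimes>\<^bsub>G\<^sub>1\<^esub> (?a \<otimes>\<^bsub>G\<^sub>1\<^esub> ?i ?b)) = ?a \<otimes>\<^bsub>G\<^sub>1\<^esub> ?i ?c"
    using assms \<beta>.image_conj(1)[of y\<^sub>2 "inv\<^bsub>G\<^sub>2\<^esub> z\<^sub>2 \<otimes>\<^bsub>G\<^sub>2\<^esub> x\<^sub>2"]
      \<beta>.image_comm[of "inv\<^bsub>G\<^sub>2\<^esub> z\<^sub>2" x\<^sub>2]
    by (simp add: \<alpha>.G.m_assoc)
  show ?thesis
    using assms
    by (simp add: rho\<^sub>1_one) (simp add: rho\<^sub>1_def \<alpha>.G.word_simps conj tail)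
qed

text \<open>Put A = \<open>lam x\<^sub>1 y\<^sub>2\<close> and C =
  \<open>lam x\<^sub>1 (lam y\<^sub>1 z\<^sub>2)\<close>. On the left x2 is conjugated by A and then
  by C, on the right by C and then by C^-1 A C. Both amount to conjugation by A C.\<close>

lemma rho\<^sub>2_braid:
  assumes "x\<^sub>1 \<in> carrier G\<^sub>1" "y\<^sub>1 \<in> carrier G\<^sub>1" "z\<^sub>1 \<in> carrier G\<^sub>1"
    and "x\<^sub>2 \<in> carrier G\<^sub>2" "y\<^sub>2 \<in> carrier G\<^sub>2" "z\<^sub>2 \<in> carrier G\<^sub>2"
  shows "rho\<^sub>2 z\<^sub>2 (rho\<^sub>1 y\<^sub>1 y\<^sub>2 x\<^sub>1 x\<^sub>2) (rho\<^sub>2 y\<^sub>2 x\<^sub>1 x\<^sub>2) =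
    rho\<^sub>2 (rho\<^sub>2 z\<^sub>2 y\<^sub>1 y\<^sub>2) (rho\<^sub>1 \<one>\<^bsub>G\<^sub>1\<^esub> (lam y\<^sub>1 z\<^sub>2) x\<^sub>1 x\<^sub>2) (rho\<^sub>2 (lam y\<^sub>1 z\<^sub>2) x\<^sub>1 x\<^sub>2)"
  using assms
  by (simp add: rho\<^sub>2_def lam_def[of "rho\<^sub>1 _ _ _ _"])
    (simp add: lam_def \<alpha>.H.word_simps)

lemma ybe_solution: "ybe_solution (carrier (G\<^sub>1 \<times>\<times> G\<^sub>2)) (prod_R G\<^sub>1 G\<^sub>2 \<alpha> \<beta>)"
proof -
  let ?l = "\<lambda>(x\<^sub>1, x\<^sub>2) (y\<^sub>1, y\<^sub>2). (\<one>\<^bsub>G\<^sub>1\<^esub>, lam x\<^sub>1 y\<^sub>2)"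
  let ?r = "\<lambda>(y\<^sub>1, y\<^sub>2) (x\<^sub>1, x\<^sub>2). (rho\<^sub>1 y\<^sub>1 y\<^sub>2 x\<^sub>1 x\<^sub>2, rho\<^sub>2 y\<^sub>2 x\<^sub>1 x\<^sub>2)"
  show ?thesis
  proof (rule ybe_solutionI[where l = ?l and r = ?r])
    fix x y z :: "'a \<times> 'c"
    assume xyz: "x \<in> carrier (G\<^sub>1 \<times>\<times> G\<^sub>2)" "y \<in> carrier (G\<^sub>1 \<times>\<times> G\<^sub>2)" "z \<in> carrier (G\<^sub>1 \<times>\<times> G\<^sub>2)"
    obtain x\<^sub>1 x\<^sub>2 y\<^sub>1 y\<^sub>2 z\<^sub>1 z\<^sub>2 where eqs: "x = (x\<^sub>1, x\<^sub>2)" "y = (y\<^sub>1, y\<^sub>2)" "z = (z\<^sub>1, z\<^sub>2)"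
      by (metis prod.exhaust)
    have mem: "x\<^sub>1 \<in> carrier G\<^sub>1" "y\<^sub>1 \<in> carrier G\<^sub>1" "z\<^sub>1 \<in> carrier G\<^sub>1"
      "x\<^sub>2 \<in> carrier G\<^sub>2" "y\<^sub>2 \<in> carrier G\<^sub>2" "z\<^sub>2 \<in> carrier G\<^sub>2"
      using xyz by (simp_all add: eqs)
    have "lam \<one>\<^bsub>G\<^sub>1\<^esub> (lam (rho\<^sub>1 y\<^sub>1 y\<^sub>2 x\<^sub>1 x\<^sub>2) z\<^sub>2) = lam x\<^sub>1 (lam y\<^sub>1 z\<^sub>2)"
      using mem by (simp add: lam_def \<alpha>.H.word_simps)
    then show "?l (?l x y) (?l (?r y x) z) = ?l x (?l y z)"
      by (simp add: eqs)
    have "rho\<^sub>1 \<one>\<^bsub>G\<^sub>1\<^esub> (lam (rho\<^sub>1 y\<^sub>1 y\<^sub>2 x\<^sub>1 x\<^sub>2) z\<^sub>2) \<one>\<^bsub>G\<^sub>1\<^esub> (lam x\<^sub>1 y\<^sub>2) = \<one>\<^bsub>G\<^sub>1\<^esub>"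
      using mem by (simp add: rho\<^sub>1_one)
    \<comment> \<open>With A = \<open>lam x\<^sub>1 y\<^sub>2\<close> and C =
      \<open>lam x\<^sub>1 (lam y\<^sub>1 z\<^sub>2)\<close>, both sides are C^-1 A C: the left by
      the definition of \<open>rho\<^sub>2\<close>, the right because conjugation by \<alpha> x1 is
      multiplicative.\<close>
    moreover have "rho\<^sub>2 (lam (rho\<^sub>1 y\<^sub>1 y\<^sub>2 x\<^sub>1 x\<^sub>2) z\<^sub>2) \<one>\<^bsub>G\<^sub>1\<^esub> (lam x\<^sub>1 y\<^sub>2) =
        lam (rho\<^sub>1 \<one>\<^bsub>G\<^sub>1\<^esub> (lam y\<^sub>1 z\<^sub>2) x\<^sub>1 x\<^sub>2) (rho\<^sub>2 z\<^sub>2 y\<^sub>1 y\<^sub>2)"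
      using mem by (simp add: lam_def rho\<^sub>2_def) (simp add: lam_def \<alpha>.H.word_simps)
    ultimately show "?r (?l (?r y x) z) (?l x y) = ?l (?r (?l y z) x) (?r z y)"
      by (simp add: eqs)
    show "?r z (?r y x) = ?r (?r z y) (?r (?l y z) x)"
      using rho\<^sub>1_braid[OF mem] rho\<^sub>2_braid[OF mem] by (simp add: eqs)
  qed (auto simp: prod_R_eq)
qed

lemma right_nondegenerate:
  "right_nondegenerate (carrier (G\<^sub>1 \<times>\<times> G\<^sub>2)) (prod_R G\<^sub>1 G\<^sub>2 \<alpha> \<beta>)"
  unfolding right_nondegenerate_def
proof
  fix y assume "y \<in> carrier (G\<^sub>1 \<times>\<times> G\<^sub>2)"
  then obtain y\<^sub>1 y\<^sub>2 where y: "y = (y\<^sub>1, y\<^sub>2)" "y\<^sub>1 \<in> carrier G\<^sub>1" "y\<^sub>2 \<in> carrier G\<^sub>2"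
    by auto
  \<comment> \<open>The inverse map comes from solving w = \<rho>(x) for x. As \<beta> x2 = \<beta>
    w2, undoing the outer conjugation in w1 and dividing by the conjugate of y1 gives x1.\<close>
  define g\<^sub>1 where "g\<^sub>1 w\<^sub>1 w\<^sub>2 = (inv\<^bsub>G\<^sub>1\<^esub> \<beta> y\<^sub>2 \<otimes>\<^bsub>G\<^sub>1\<^esub> w\<^sub>1 \<otimes>\<^bsub>G\<^sub>1\<^esub> \<beta> y\<^sub>2) \<otimes>\<^bsub>G\<^sub>1\<^esub>
    (inv\<^bsub>G\<^sub>1\<^esub> \<beta> w\<^sub>2 \<otimes>\<^bsub>G\<^sub>1\<^esub> inv\<^bsub>G\<^sub>1\<^esub> y\<^sub>1 \<otimes>\<^bsub>G\<^sub>1\<^esub> \<beta> w\<^sub>2)" for w\<^sub>1 w\<^sub>2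
  \<comment> \<open>\<open>q w\<^sub>1\<close> recovers \<open>lam x\<^sub>1 y\<^sub>2\<close>,
    since \<alpha> x1 = \<alpha>(w1 y1^-1). Conjugating w2 back by it then gives x2.\<close>
  define q where "q w\<^sub>1 = lam (w\<^sub>1 \<otimes>\<^bsub>G\<^sub>1\<^esub> inv\<^bsub>G\<^sub>1\<^esub> y\<^sub>1) y\<^sub>2" for w\<^sub>1
  define g\<^sub>2 where "g\<^sub>2 w\<^sub>1 w\<^sub>2 = q w\<^sub>1 \<otimes>\<^bsub>G\<^sub>2\<^esub> w\<^sub>2 \<otimes>\<^bsub>G\<^sub>2\<^esub> inv\<^bsub>G\<^sub>2\<^esub> q w\<^sub>1" for w\<^sub>1 w\<^sub>2
  have g_closed [simp]: "q w\<^sub>1 \<in> carrier G\<^sub>2" "g\<^sub>1 w\<^sub>1 w\<^sub>2 \<in> carrier G\<^sub>1" "g\<^sub>2 w\<^sub>1 w\<^sub>2 \<in> carrier G\<^sub>2"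
    if "w\<^sub>1 \<in> carrier G\<^sub>1" "w\<^sub>2 \<in> carrier G\<^sub>2" for w\<^sub>1 w\<^sub>2
    using that y by (simp_all add: g\<^sub>1_def g\<^sub>2_def q_def)
  show "bij_betw (\<lambda>x. snd (prod_R G\<^sub>1 G\<^sub>2 \<alpha> \<beta> (x, y))) (carrier (G\<^sub>1 \<times>\<times> G\<^sub>2)) (carrier (G\<^sub>1 \<times>\<times> G\<^sub>2))"
  proof (rule bij_betwI[where g = "\<lambda>(w\<^sub>1, w\<^sub>2). (g\<^sub>1 w\<^sub>1 w\<^sub>2, g\<^sub>2 w\<^sub>1 w\<^sub>2)"])
    fix x assume "x \<in> carrier (G\<^sub>1 \<times>\<times> G\<^sub>2)"
    then obtain x\<^sub>1 x\<^sub>2 where x: "x = (x\<^sub>1, x\<^sub>2)" "x\<^sub>1 \<in> carrier G\<^sub>1" "x\<^sub>2 \<in> carrier G\<^sub>2"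
      by auto
    have "g\<^sub>1 (rho\<^sub>1 y\<^sub>1 y\<^sub>2 x\<^sub>1 x\<^sub>2) (rho\<^sub>2 y\<^sub>2 x\<^sub>1 x\<^sub>2) = x\<^sub>1"
      using x y by (simp add: g\<^sub>1_def) (simp add: rho\<^sub>1_def \<alpha>.G.word_simps)
    \<comment> \<open>\<alpha> sends \<open>rho\<^sub>1\<close> times y1^-1 to the conjugate of
      \<alpha> x1 by \<alpha> y1, which is \<alpha> x1 itself.\<close>
    moreover have "q (rho\<^sub>1 y\<^sub>1 y\<^sub>2 x\<^sub>1 x\<^sub>2) = lam x\<^sub>1 y\<^sub>2"
      using x y by (simp add: q_def lam_def \<alpha>.image_conj)
    then have "g\<^sub>2 (rho\<^sub>1 y\<^sub>1 y\<^sub>2 x\<^sub>1 x\<^sub>2) (rho\<^sub>2 y\<^sub>2 x\<^sub>1 x\<^sub>2) = x\<^sub>2"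
      using x y by (simp add: g\<^sub>2_def rho\<^sub>2_def \<alpha>.H.m_assoc)
    ultimately show "(case snd (prod_R G\<^sub>1 G\<^sub>2 \<alpha> \<beta> (x, y)) of
        (w\<^sub>1, w\<^sub>2) \<Rightarrow> (g\<^sub>1 w\<^sub>1 w\<^sub>2, g\<^sub>2 w\<^sub>1 w\<^sub>2)) = x"
      using x y by (simp add: prod_R_eq)
  next
    fix w assume "w \<in> carrier (G\<^sub>1 \<times>\<times> G\<^sub>2)"
    then obtain w\<^sub>1 w\<^sub>2 where w: "w = (w\<^sub>1, w\<^sub>2)" "w\<^sub>1 \<in> carrier G\<^sub>1" "w\<^sub>2 \<in> carrier G\<^sub>2"
      by auto
    have \<beta>g: "\<beta> (g\<^sub>2 w\<^sub>1 w\<^sub>2) = \<beta> w\<^sub>2"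
      using w y by (simp add: g\<^sub>2_def \<beta>.hom_conj del: \<beta>.hom_mult)
    \<comment> \<open>The two factors of \<open>g\<^sub>1\<close> are conjugates of w1 and of
      y1^-1.\<close>
    have "\<alpha> (g\<^sub>1 w\<^sub>1 w\<^sub>2) = \<alpha> w\<^sub>1 \<otimes>\<^bsub>G\<^sub>2\<^esub> inv\<^bsub>G\<^sub>2\<^esub> \<alpha> y\<^sub>1"
      unfolding g\<^sub>1_def using w y
      by (subst \<alpha>.hom_mult) (simp_all add: \<alpha>.hom_conj del: \<alpha>.hom_mult)
    then have "lam (g\<^sub>1 w\<^sub>1 w\<^sub>2) y\<^sub>2 = q w\<^sub>1"
      using w y by (simp add: lam_def q_def)
    then have "rho\<^sub>2 y\<^sub>2 (g\<^sub>1 w\<^sub>1 w\<^sub>2) (g\<^sub>2 w\<^sub>1 w\<^sub>2) = w\<^sub>2"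
      using w y by (simp add: rho\<^sub>2_def g\<^sub>2_def \<alpha>.H.m_assoc)
    moreover have "rho\<^sub>1 y\<^sub>1 y\<^sub>2 (g\<^sub>1 w\<^sub>1 w\<^sub>2) (g\<^sub>2 w\<^sub>1 w\<^sub>2) = w\<^sub>1"
      using w y by (simp add: rho\<^sub>1_def \<beta>g) (simp add: g\<^sub>1_def \<alpha>.G.word_simps)
    ultimately show "snd (prod_R G\<^sub>1 G\<^sub>2 \<alpha> \<beta> (case w of (w\<^sub>1, w\<^sub>2) \<Rightarrow> (g\<^sub>1 w\<^sub>1 w\<^sub>2, g\<^sub>2 w\<^sub>1 w\<^sub>2), y)) = w"
      using w y by (simp add: prod_R_eq)
  qed (use y in \<open>auto simp: prod_R_eq\<close>)
qed

end

theorem theorem3: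
  fixes G :: "('g, 'm) monoid_scheme" and \<psi> :: "'g \<Rightarrow> 'g"
    and G\<^sub>1 :: "('a, 'm1) monoid_scheme" and G\<^sub>2 :: "('b, 'm2) monoid_scheme"
    and \<alpha> :: "'a \<Rightarrow> 'b" and \<beta> :: "'b \<Rightarrow> 'a"
  shows "(group G \<and> abelian_map G G \<psi> \<and> (\<forall>g \<in> carrier G. (\<psi> \<circ> \<psi>) g = \<psi> g) \<longrightarrow>
            ybe_solution (carrier G) (idem_R G \<psi>) \<and>
            right_nondegenerate (carrier G) (idem_R G \<psi>)) \<and>
         (group G\<^sub>1 \<and> group G\<^sub>2 \<and> abelian_map G\<^sub>1 G\<^sub>2 \<alpha> \<and> abelian_map G\<^sub>2 G\<^sub>1 \<beta> \<longrightarrow>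
            ybe_solution (carrier (G\<^sub>1 \<times>\<times> G\<^sub>2)) (prod_R G\<^sub>1 G\<^sub>2 \<alpha> \<beta>) \<and>
            right_nondegenerate (carrier (G\<^sub>1 \<times>\<times> G\<^sub>2)) (prod_R G\<^sub>1 G\<^sub>2 \<alpha> \<beta>))"
proof (intro conjI impI; elim conjE)
  assume "group G" "abelian_map G G \<psi>" "\<forall>g \<in> carrier G. (\<psi> \<circ> \<psi>) g = \<psi> g"
  then interpret idempotent_abelian_map G \<psi>
    by (simp add: idempotent_abelian_map_def idempotent_abelian_map_axioms_def abelian_image_homI)
  show "ybe_solution (carrier G) (idem_R G \<psi>)" "right_nondegenerate (carrier G) (idem_R G \<psi>)"
    by (fact ybe_solution right_nondegenerate)+
next
  assume "group G\<^sub>1" "group G\<^sub>2" "abelian_map G\<^sub>1 G\<^sub>2 \<alpha>" "abelian_map G\<^sub>2 G\<^sub>1 \<beta>"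
  then interpret abelian_map_pair G\<^sub>1 G\<^sub>2 \<alpha> \<beta>
    by (simp add: abelian_map_pair_def abelian_image_homI)
  show "ybe_solution (carrier (G\<^sub>1 \<times>\<times> G\<^sub>2)) (prod_R G\<^sub>1 G\<^sub>2 \<alpha> \<beta>)"
    "right_nondegenerate (carrier (G\<^sub>1 \<times>\<times> G\<^sub>2)) (prod_R G\<^sub>1 G\<^sub>2 \<alpha> \<beta>)"
    by (fact ybe_solution right_nondegenerate)+
qed

end
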